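(* Let $k, m \geq 1$ be integers, let $G = G(k,m)$ be the spatial graph with three ordered edges $a,b,c$ described in the context, and let $N=(2,2,m)$ (so $a,b$ are labeled $2$ and $c$ is labeled $m$). Then the fundamental $N$-quandle of $G$ is finite and $$\vert Q_N(G)\vert = 2km+2k.$$
   Context: A quandle is a set $Q$ with binary operations $\rhd,\rhd^{-1}$ such that $x\rhd x=x$; $(x\rhd y)\rhd^{-1}y = x = (x\rhd^{-1}y)\rhd y$; and $(x\rhd y)\rhd z=(x\rhd z)\rhd(y\rhd z)$. Write $x^y = x\rhd y$, $x^{\bar y}=x\rhd^{-1}y$, and $x^{yz}=(x^y)^z$; thus $x^w$ makes sense for any word $w$ in elements and their formal inverses, and $y^j$ in an exponent means $y$ repeated $j$ times. Fundamental quandle. For an oriented spatial graph $G\subset \mathbb{S}^3$ with a regular diagram, the fundamental quandle $Q(G)$ is generated by the arcs of the diagram, with a relation $x_i = x_k^{x_j}$ at each crossing ($x_j$ the over-arc, $x_k$ and $x_i$ the under-arcs on its left and right respectively) and, at each vertex with incident arcs $a_1,\dots,a_r$ listed in (counterclockwise) cyclic order, the relations $((x\rhd^{\varepsilon_1}a_1)\rhd^{\varepsilon_2}a_2)\cdots\rhd^{\varepsilon_r}a_r = x$ for all $x$, where $\varepsilon_i=1$ if $a_i$ is directed into the vertex and $-1$ if out of it. If the ordered edges $e_1,\dots,e_s$ of $G$ are labeled by $N=(n_1,\dots,n_s)$, the fundamental $N$-quandle $Q_N(G)$ is the quotient of $Q(G)$ by the relations $x^{y^{n_i}}=x$ for all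 $x$, whenever $y$ is an arc of edge $e_i$. The graph $G(k,m)$. From left to right place a vertical edge (strut) $c$ and a horizontal block of $k$ right-handed half-twists on two strands. The two strand ends on the left of the block are joined to the top and bottom endpoints of $c$. The top strand end on the right of the block is continued, over the top of the picture without crossings, to the top endpoint of $c$; the bottom strand end on the right is continued, under the bottom without crossings, to the bottom endpoint of $c$. The graph has two vertices (the endpoints of $c$) and three edges: $c$, the edge $a$ containing the top right arc (also called $a$), and the edge $b$ containing the bottom right arc (also called $b$). (It is a $\theta$-graph if $k$ is odd and a handcuff graph if $k$ is even.) With $N=(2,2,m)$, eliminating the generators inside the twist block gives the presentation $$Q_N(G) = \langle a,b,c \mid x^{a^2}=x^{b^2}=x^{c^m}=x,\ x^{c(ab)^k}=x,\ x^{bc(ab)^{k-1}a}=x\rangle,$$ where each relation is imposed for every element $x$ of the quandle (equivalently, for every generator $x$). *)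

theory Defs
  imports Main
begin

section \<open>Quandles\<close>

locale quandle =
  fixes Q :: "'q set" and op :: "'q \<Rightarrow> 'q \<Rightarrow> 'q" and iop :: "'q \<Rightarrow> 'q \<Rightarrow> 'q"
  assumes op_closed: "x \<in> Q \<Longrightarrow> y \<in> Q \<Longrightarrow> op x y \<in> Q"
    and iop_closed: "x \<in> Q \<Longrightarrow> y \<in> Q \<Longrightarrow> iop x y \<in> Q"
    and idem: "x \<in> Q \<Longrightarrow> op x x = x"
    and iop_op: "x \<in> Q \<Longrightarrow> y \<in> Q \<Longrightarrow> iop (op x y) y = x"
    and op_iop: "x \<in> Q \<Longrightarrow> y \<in> Q \<Longrightarrow> op (iop x y) y = x"
    and distrib: "x \<in> Q \<Longrightarrow> y \<in> Q \<Longrightarrow> z \<in> Q \<Longrightarrow> op (op x y) z = op (op x z) (op y z)"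

section \<open>Quandles given by generators and relations\<close>

datatype 'g qterm =
    Gen 'g
  | Op "'g qterm" "'g qterm"  (infixl "\<rhd>" 65)
  | IOp "'g qterm" "'g qterm"  (infixl "\<lhd>" 65)

definition qterms :: "'g set \<Rightarrow> 'g qterm set" where
  "qterms A = {t. set_qterm t \<subseteq> A}"

text \<open>
  The least congruence on the terms over the generators \<open>A\<close> that satisfies the quandle axioms
  and contains the pairs in \<open>R\<close>.
\<close>
inductive qeq :: "'g set \<Rightarrow> ('g qterm \<times> 'g qterm) set \<Rightarrow> 'g qterm \<Rightarrow> 'g qterm \<Rightarrow> bool"
  for A R where
  rel: "(s, t) \<in> R \<Longrightarrow> s \<in> qterms A \<Longrightarrow> t \<in> qterms A \<Longrightarrow> qeq A R s t"
| refl: "t \<in> qterms A \<Longrightarrow> qeq A R t t"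
| sym: "qeq A R s t \<Longrightarrow> qeq A R t s"
| trans: "qeq A R s t \<Longrightarrow> qeq A R t u \<Longrightarrow> qeq A R s u"
| cong_op: "qeq A R s s' \<Longrightarrow> qeq A R t t' \<Longrightarrow> qeq A R (s \<rhd> t) (s' \<rhd> t')"
| cong_iop: "qeq A R s s' \<Longrightarrow> qeq A R t t' \<Longrightarrow> qeq A R (s \<lhd> t) (s' \<lhd> t')"
| idem: "x \<in> qterms A \<Longrightarrow> qeq A R (x \<rhd> x) x"
| iop_op: "x \<in> qterms A \<Longrightarrow> y \<in> qterms A \<Longrightarrow> qeq A R ((x \<rhd> y) \<lhd> y) x"
| op_iop: "x \<in> qterms A \<Longrightarrow> y \<in> qterms A \<Longrightarrow> qeq A R ((x \<lhd> y) \<rhd> y) x"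
| distrib: "x \<in> qterms A \<Longrightarrow> y \<in> qterms A \<Longrightarrow> z \<in> qterms A \<Longrightarrow>
    qeq A R ((x \<rhd> y) \<rhd> z) ((x \<rhd> z) \<rhd> (y \<rhd> z))"

definition qrel :: "'g set \<Rightarrow> ('g qterm \<times> 'g qterm) set \<Rightarrow> ('g qterm \<times> 'g qterm) set" where
  "qrel A R = {(s, t). qeq A R s t}"

definition presented :: "'g set \<Rightarrow> ('g qterm \<times> 'g qterm) set \<Rightarrow> 'g qterm set set" where
  "presented A R = qterms A // qrel A R"

definition presented_op ::
  "'g set \<Rightarrow> ('g qterm \<times> 'g qterm) set \<Rightarrow> 'g qterm set \<Rightarrow> 'g qterm set \<Rightarrow> 'g qterm set" where
  "presented_op A R X Y = (\<Union>x\<in>X. \<Union>y\<in>Y. qrel A R `` {x \<rhd> y})"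

definition presented_iop ::
  "'g set \<Rightarrow> ('g qterm \<times> 'g qterm) set \<Rightarrow> 'g qterm set \<Rightarrow> 'g qterm set \<Rightarrow> 'g qterm set" where
  "presented_iop A R X Y = (\<Union>x\<in>X. \<Union>y\<in>Y. qrel A R `` {x \<lhd> y})"

lemma qterms_simps [simp]:
  "Gen g \<in> qterms A \<longleftrightarrow> g \<in> A"
  "x \<rhd> y \<in> qterms A \<longleftrightarrow> x \<in> qterms A \<and> y \<in> qterms A"
  "x \<lhd> y \<in> qterms A \<longleftrightarrow> x \<in> qterms A \<and> y \<in> qterms A"
  by (auto simp: qterms_def)

lemma qeq_qterms: "qeq A R s t \<Longrightarrow> s \<in> qterms A \<and> t \<in> qterms A"
  by (induction rule: qeq.induct) auto

lemma equiv_qrel: "equiv (qterms A) (qrel A R)"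
  by (rule equivI)
    (auto simp: qrel_def refl_on_def sym_def trans_def
      intro: qeq.refl qeq.sym qeq.trans dest: qeq_qterms)

lemma presented_op_class:
  assumes "x \<in> qterms A" "y \<in> qterms A"
  shows "presented_op A R (qrel A R `` {x}) (qrel A R `` {y}) = qrel A R `` {x \<rhd> y}"
  unfolding presented_op_def using assms
  by (intro UN_equiv_class2[OF equiv_qrel equiv_qrel])
    (auto simp: congruent2_def intro!: equiv_class_eq[OF equiv_qrel],
     auto simp: qrel_def intro: qeq.cong_op)

lemma presented_iop_class:
  assumes "x \<in> qterms A" "y \<in> qterms A"
  shows "presented_iop A R (qrel A R `` {x}) (qrel A R `` {y}) = qrel A R `` {x \<lhd> y}"
  unfolding presented_iop_def using assms
  by (intro UN_equiv_class2[OF equiv_qrel equiv_qrel])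
    (auto simp: congruent2_def intro!: equiv_class_eq[OF equiv_qrel],
     auto simp: qrel_def intro: qeq.cong_iop)

lemma qrel_class_eq: "qeq A R s t \<Longrightarrow> qrel A R `` {s} = qrel A R `` {t}"
  by (rule equiv_class_eq[OF equiv_qrel]) (simp add: qrel_def)

theorem quandle_presented:
  "quandle (presented A R) (presented_op A R) (presented_iop A R)"
  by unfold_locales
    (erule quotientE[of _ "qterms A" "qrel A R", folded presented_def] |
     simp add: presented_op_class presented_iop_class |
     rule quotientI[of _ "qterms A" "qrel A R", folded presented_def] qrel_class_eq |
     rule qeq.idem qeq.iop_op qeq.op_iop qeq.distrib)+

primrec qeval :: "('q \<Rightarrow> 'q \<Rightarrow> 'q) \<Rightarrow> ('q \<Rightarrow> 'q \<Rightarrow> 'q) \<Rightarrow> ('g \<Rightarrow> 'q) \<Rightarrow> 'g qterm \<Rightarrow> 'q" where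
  "qeval op iop f (Gen g) = f g"
| "qeval op iop f (x \<rhd> y) = op (qeval op iop f x) (qeval op iop f y)"
| "qeval op iop f (x \<lhd> y) = iop (qeval op iop f x) (qeval op iop f y)"

lemma (in quandle) qeval_closed:
  assumes "f ` A \<subseteq> Q" and "t \<in> qterms A"
  shows "qeval op iop f t \<in> Q"
  using assms(2) by (induction t) (use assms(1) in \<open>auto intro: op_closed iop_closed\<close>)

text \<open>
  Universal property: an assignment of the generators to elements of a quandle that respects
  \<open>R\<close> factors through the presented quandle.
\<close>
theorem (in quandle) qeval_respects:
  assumes "f ` A \<subseteq> Q"
    and "\<And>s t. (s, t) \<in> R \<Longrightarrow> s \<in> qterms A \<Longrightarrow> t \<in> qterms A \<Longrightarrow>
           qeval op iop f s = qeval op iop f t"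
    and "qeq A R s t"
  shows "qeval op iop f s = qeval op iop f t"
  using assms(3)
  by (induction rule: qeq.induct)
    (simp_all add: assms(2) qeval_closed[OF assms(1)] idem iop_op op_iop distrib)

section \<open>Fundamental quandles of spatial graph diagrams\<close>

text \<open>
  The combinatorial data of a regular diagram of an oriented spatial graph.
  A crossing is a triple \<open>(x\<^sub>k, x\<^sub>j, x\<^sub>i)\<close>: the under-arc on the left of the over-arc,
  the over-arc, and the under-arc on its right.  A vertex is the counterclockwise list of the
  incident arcs, each marked \<open>True\<close> if it is directed into the vertex and
  \<open>False\<close> if it is directed out of it.  Edges are numbered from 0.
\<close>
record 'a diagram =
  arcs :: "'a set"
  crossings :: "('a \<times> 'a \<times> 'a) set"
  vertices :: "('a \<times> bool) list set"
  edge_of :: "'a \<Rightarrow> nat"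

definition signed_op :: "'a qterm \<Rightarrow> 'a \<times> bool \<Rightarrow> 'a qterm" where
  "signed_op x p = (if snd p then x \<rhd> Gen (fst p) else x \<lhd> Gen (fst p))"

definition diagram_rels :: "'a diagram \<Rightarrow> ('a qterm \<times> 'a qterm) set" where
  "diagram_rels D =
     {(Gen xi, Gen xk \<rhd> Gen xj) | xi xj xk. (xk, xj, xi) \<in> crossings D} \<union>
     {(foldl signed_op x v, x) | x v. x \<in> qterms (arcs D) \<and> v \<in> vertices D}"

definition label_rels :: "'a diagram \<Rightarrow> nat list \<Rightarrow> ('a qterm \<times> 'a qterm) set" where
  "label_rels D N =
     {(((\<lambda>t. t \<rhd> Gen y) ^^ (N ! edge_of D y)) x, x) | x y. x \<in> qterms (arcs D) \<and> y \<in> arcs D}"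

definition fundamental_quandle :: "'a diagram \<Rightarrow> 'a qterm set set" where
  "fundamental_quandle D = presented (arcs D) (diagram_rels D)"

definition fundamental_N_quandle :: "'a diagram \<Rightarrow> nat list \<Rightarrow> 'a qterm set set" where
  "fundamental_N_quandle D N = presented (arcs D) (diagram_rels D \<union> label_rels D N)"

section \<open>The graph G(k,m)\<close>

text \<open>
  Draw the strut to the left of the twist block.  In a horizontal block of right-handed
  half-twists the over-strand of every crossing descends from upper left to lower right (such
  crossings are positive when the strands are oriented in parallel).  Number the crossings
  \<open>0, ..., k - 1\<close> from left to right.  To the left of crossing \<open>i\<close> the bottom strand is
  \<open>Strand i\<close> and the top strand is \<open>Strand (i + 1)\<close>; the latter passes over and is the bottom
  strand on the right of the crossing, where the top strand is \<open>Strand (i + 2)\<close>.  Hence the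
  ends of the block are: bottom left \<open>Strand 0\<close>, top left \<open>Strand 1\<close>, bottom right \<open>Strand k\<close>
  (the arc \<open>b\<close>), top right \<open>Strand (k + 1)\<close> (the arc \<open>a\<close>).
\<close>
datatype G_arc = Strut | Strand nat

text \<open>
  The edges \<open>a\<close>, \<open>b\<close>, \<open>c\<close> have numbers 0, 1, 2.  Going under a crossing changes the index of
  a strand by 2, so its parity decides between \<open>a\<close> and \<open>b\<close>.
\<close>
fun G_edge :: "nat \<Rightarrow> G_arc \<Rightarrow> nat" where
  "G_edge k Strut = 2"
| "G_edge k (Strand j) = (if even (k + 1 + j) then 0 else 1)"

text \<open>
  Within the block every strand is monotone from left to right, so an orientation of the graph
  is a map \<open>d\<close> on the edge numbers, where \<open>d 0\<close> and \<open>d 1\<close> say whether \<open>a\<close> and \<open>b\<close> run from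
  left to right through the block and \<open>d 2\<close> says whether \<open>c\<close> runs downwards.  If the over-strand
  runs to the right, it has \<open>Strand (i + 2)\<close> on its left.  Both vertices are read
  counterclockwise starting at the strut: at the upper one there follow the top left
  end and then the strand from the top right passing above the picture; at the lower one the
  strand from the bottom right passing below the picture and then the bottom left end.
\<close>
definition G_diagram :: "nat \<Rightarrow> (nat \<Rightarrow> bool) \<Rightarrow> G_arc diagram" where
  "G_diagram k d =
    (let right = (\<lambda>j. d (G_edge k (Strand j))) in
     \<lparr> arcs = insert Strut (Strand ` {0..k + 1}),
       crossings =
         {if right (i + 1) then (Strand (i + 2), Strand (i + 1), Strand i)
          else (Strand i, Strand (i + 1), Strand (i + 2)) | i. i < k},
       vertices =
         {[(Strut, \<not> d 2), (Strand 1, \<not> right 1), (Strand (k + 1), right (k + 1))],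
          [(Strut, d 2), (Strand k, right k), (Strand 0, \<not> right 0)]},
       edge_of = G_edge k \<rparr>)"

end

theory Submission imports Defs begin

text \<open>
  Since every strand acts as an involution, the crossing relations say that the product of the
  actions of two consecutive strands is always the same operator \<open>rot\<close>, and each vertex relation
  says that the strut acts as \<open>rot\<close> to the power \<open>k\<close> or its inverse.  So the strands act through
  the dihedral group of order \<open>2 * k * m\<close>: the orbits of the strands contain at most \<open>2 * k * m\<close>
  elements together, and the orbit of the strut, whose stabilizer contains \<open>rot ^^ k\<close>, has at most
  \<open>2 * k\<close>.  Equality holds because the cosets of these stabilizers do form a quandle satisfying
  the relations.
\<close>

section \<open>Quandles generated by a family\<close>

context quandle
begin

text \<open>Right translations are automorphisms, so they conjugate actions. With the three variants
  below, the action of any term reduces to actions of generators and their inverses.\<close>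

lemma op_conj:
  assumes "x \<in> Q" "y \<in> Q" "z \<in> Q"
  shows "op x (op y z) = op (op (iop x z) y) z"
  using assms distrib[of "iop x z" y z] by (simp add: iop_closed op_iop)

lemma iop_eq_iff:
  assumes "x \<in> Q" "y \<in> Q" "z \<in> Q"
  shows "iop x z = y \<longleftrightarrow> x = op y z"
  using assms iop_op op_iop by metis

lemma iop_conj_op:
  assumes "x \<in> Q" "y \<in> Q" "z \<in> Q"
  shows "iop x (op y z) = op (iop (iop x z) y) z"
  using assms by (simp add: iop_eq_iff op_conj op_closed iop_closed iop_op op_iop)

lemma op_conj_iop:
  assumes "x \<in> Q" "y \<in> Q" "z \<in> Q"
  shows "op x (iop y z) = iop (op (op x z) y) z"
  using assms op_conj[of "op x z" "iop y z" z]
  by (simp add: op_closed iop_closed iop_op op_iop)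

lemma iop_conj_iop:
  assumes "x \<in> Q" "y \<in> Q" "z \<in> Q"
  shows "iop x (iop y z) = iop (iop (op x z) y) z"
  using assms by (simp add: iop_eq_iff op_conj_iop op_closed iop_closed iop_op op_iop)

text \<open>By the conjugation formulas every term acts through the generators and their inverses,
  so stability under these suffices.\<close>

lemma qeval_mem_closed:
  assumes "I \<subseteq> Q" and gen: "f ` A \<subseteq> I"
    and op: "\<And>x g. x \<in> I \<Longrightarrow> g \<in> A \<Longrightarrow> op x (f g) \<in> I"
    and iop: "\<And>x g. x \<in> I \<Longrightarrow> g \<in> A \<Longrightarrow> iop x (f g) \<in> I"
    and t: "t \<in> qterms A"
  shows "qeval op iop f t \<in> I"
proof -
  let ?e = "qeval op iop f"
  have closed: "?e t \<in> Q" if "t \<in> qterms A" for t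
    using qeval_closed[of f A t] that assms(1) gen by blast
  have act: "\<forall>x\<in>I. op x (?e t) \<in> I \<and> iop x (?e t) \<in> I" if "t \<in> qterms A" for t
    using that
  proof (induction t)
    case (Gen g)
    then show ?case using op iop by simp
  next
    case (Op y z)
    then show ?case
      using closed assms(1) by (auto simp: op_conj iop_conj_op subset_iff)
  next
    case (IOp y z)
    then show ?case
      using closed assms(1) by (auto simp: op_conj_iop iop_conj_iop subset_iff)
  qed
  show ?thesis
    using t by (induction t) (use gen act in auto)
qed

end

lemma qeval_presented:
  assumes "t \<in> qterms A"
  shows "qeval (presented_op A R) (presented_iop A R) (\<lambda>g. qrel A R `` {Gen g}) t = qrel A R `` {t}"
  using assms by (induction t) (simp_all add: presented_op_class presented_iop_class)

lemma qeval_funpow_op: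
  "qeval op iop f (((\<lambda>t. t \<rhd> Gen y) ^^ n) x) = ((\<lambda>q. op q (f y)) ^^ n) (qeval op iop f x)"
  by (induction n) simp_all

lemma funpow_mem: "(\<And>x. x \<in> A \<Longrightarrow> h x \<in> A) \<Longrightarrow> x \<in> A \<Longrightarrow> (h ^^ n) x \<in> A"
  by (induction n) auto

lemma periodic_mod:
  fixes f :: "nat \<Rightarrow> 'a"
  assumes "\<And>j. f (j + p) = f j"
  shows "f (j mod p) = f j"
proof -
  have "f (i + p * n) = f i" for i n
  proof (induction n)
    case (Suc n)
    then show ?case using assms[of "i + p * n"] by (simp add: algebra_simps)
  qed simp
  from this[of "j mod p" "j div p"] show ?thesis by (simp only: mod_mult_div_eq)
qed

section \<open>Upper bound\<close>

text \<open>
  \<open>T\<close> continues the sequence of strands beyond the end of the twist block.  Which of the two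
  disjuncts of \<open>vertex\<close> holds depends on the orientation of the strut.
\<close>
locale twisted_quandle = quandle Q op iop
  for Q :: "'q set" and op iop +
  fixes k m :: nat and T :: "nat \<Rightarrow> 'q" and c :: 'q
  assumes k: "k \<ge> 1" and m: "m \<ge> 1"
    and T_base: "T 0 \<in> Q" "T (Suc 0) \<in> Q"
    and c_closed: "c \<in> Q"
    and T_rec: "T (Suc (Suc j)) = op (T j) (T (Suc j))"
    and invol_base: "x \<in> Q \<Longrightarrow> op (op x (T 0)) (T 0) = x"
      "x \<in> Q \<Longrightarrow> op (op x (T (Suc 0))) (T (Suc 0)) = x"
    and vertex: "(\<forall>x\<in>Q. op x c = op (op x (T (Suc k))) (T (Suc 0))) \<or>
      (\<forall>x\<in>Q. iop x c = op (op x (T (Suc k))) (T (Suc 0)))"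
    and c_order: "x \<in> Q \<Longrightarrow> ((\<lambda>x. op x c) ^^ m) x = x"
begin

section \<open>Dihedral relations between the strand actions\<close>

definition rot :: "'q \<Rightarrow> 'q" where
  "rot x = op (op x (T (Suc 0))) (T 0)"

lemma T_closed_pair: "T j \<in> Q \<and> T (Suc j) \<in> Q"
  by (induction j) (auto simp: T_base T_rec intro: op_closed)

lemma T_closed [simp]: "T j \<in> Q"
  using T_closed_pair by blast

lemma iop_if_invol:
  assumes "x \<in> Q" "y \<in> Q" "\<And>x. x \<in> Q \<Longrightarrow> op (op x y) y = x"
  shows "iop x y = op x y"
  using assms by (simp add: iop_eq_iff op_closed)

text \<open>A conjugate of an involution is an involution. Two consecutive indices are carried along
  because \<open>T_rec\<close> looks back two steps.\<close>

lemma invol_pair: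
  "(\<forall>x\<in>Q. op (op x (T j)) (T j) = x) \<and> (\<forall>x\<in>Q. op (op x (T (Suc j))) (T (Suc j)) = x)"
proof (induction j)
  case 0
  then show ?case using invol_base by simp
next
  case (Suc j)
  then show ?case
    by (auto simp: T_rec op_conj op_closed iop_if_invol)
qed

lemma invol [simp]: "x \<in> Q \<Longrightarrow> op (op x (T j)) (T j) = x"
  using invol_pair by blast

lemma iop_T: "x \<in> Q \<Longrightarrow> iop x (T j) = op x (T j)"
  by (rule iop_if_invol) auto

lemma op_T_rec:
  "x \<in> Q \<Longrightarrow> op x (T (Suc (Suc j))) = op (op (op x (T (Suc j))) (T j)) (T (Suc j))"
  by (simp add: T_rec op_conj iop_T)

lemma rot_closed [simp]: "x \<in> Q \<Longrightarrow> rot x \<in> Q"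
  by (simp add: rot_def op_closed)

lemma rot_pow_closed [simp]: "x \<in> Q \<Longrightarrow> (rot ^^ n) x \<in> Q"
  by (rule funpow_mem) auto

text \<open>\<open>T (j + 2)\<close> acts as \<open>T (j + 1)\<close>, \<open>T j\<close>,
  \<open>T (j + 1)\<close> in turn, and a further \<open>T (j + 1)\<close> cancels the last
  factor.\<close>

lemma rot_shift: "x \<in> Q \<Longrightarrow> op (op x (T (Suc j))) (T j) = rot x"
  by (induction j) (simp_all add: rot_def op_T_rec op_closed)

lemma rot_T: "rot (T (Suc (Suc j))) = T j"
  using rot_shift[of "T (Suc (Suc j))" j] by (simp add: T_rec idem op_closed)

lemma rot_pow_T: "(rot ^^ n) (T (j + 2 * n)) = T j"
proof (induction n arbitrary: j)
  case (Suc n)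
  have "(rot ^^ n) (rot (T (j + 2 * Suc n))) = T j"
    using Suc[of j] rot_T[of "j + 2 * n"] by simp
  then show ?case by (simp add: funpow_swap1)
qed simp

lemma rot_pow: "x \<in> Q \<Longrightarrow> op (op x (T (j + n))) (T j) = (rot ^^ n) x"
proof (induction n arbitrary: x)
  case (Suc n)
  let ?y = "op x (T (Suc (j + n)))"
  \<comment> \<open>Inserting the involution \<open>T (j + n)\<close> twice splits off a product of
    neighbours, to which \<open>rot_shift\<close> applies.\<close>
  have "op ?y (T j) = op (op (op ?y (T (j + n))) (T (j + n))) (T j)"
    using Suc.prems by (simp add: op_closed)
  also have "\<dots> = (rot ^^ n) (rot x)"
    using Suc by (simp add: rot_shift)
  finally show ?case by (simp add: funpow_swap1)
qed simp

section \<open>Vertex relation, order of the rotation and periods\<close>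

lemma vertex_rot: "(\<forall>x\<in>Q. op x c = (rot ^^ k) x) \<or> (\<forall>x\<in>Q. iop x c = (rot ^^ k) x)"
  using vertex rot_pow[of _ "Suc 0" k] by auto

text \<open>By idempotence \<open>c\<close> acts trivially on itself, and \<open>rot ^^ k\<close> is
  this action or its inverse.\<close>

lemma rot_c: "(rot ^^ k) c = c"
  using vertex_rot idem[OF c_closed] iop_op[OF c_closed c_closed] c_closed by metis

lemma rot_order:
  assumes "x \<in> Q"
  shows "(rot ^^ (k * m)) x = x"
  using vertex_rot
proof
  assume op: "\<forall>x\<in>Q. op x c = (rot ^^ k) x"
  have "((rot ^^ k) ^^ n) x = ((\<lambda>x. op x c) ^^ n) x" for n
  proof (induction n)
    case (Suc n)
    have "((\<lambda>x. op x c) ^^ n) x \<in> Q"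
      by (rule funpow_mem) (use assms in \<open>auto intro: op_closed c_closed\<close>)
    then show ?case using Suc op by simp
  qed simp
  from this[of m] show ?thesis using c_order[OF assms] by (simp add: funpow_mult mult.commute)
next
  assume iop: "\<forall>x\<in>Q. iop x c = (rot ^^ k) x"
  \<comment> \<open>Here \<open>rot ^^ k\<close> undoes one action of \<open>c\<close>, so the
    powers cancel from the inside; for \<open>n = m\<close> the actions of \<open>c\<close> alone
    give the identity.\<close>
  have "((rot ^^ k) ^^ n) (((\<lambda>x. op x c) ^^ n) x) = x" for n
  proof (induction n)
    case (Suc n)
    have "((\<lambda>x. op x c) ^^ n) x \<in> Q"
      by (rule funpow_mem) (use assms in \<open>auto intro: op_closed c_closed\<close>)
    then have "(rot ^^ k) (op (((\<lambda>x. op x c) ^^ n) x) c) = ((\<lambda>x. op x c) ^^ n) x"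
      using iop iop_op op_closed c_closed by metis
    then show ?case using Suc by (simp only: funpow_Suc_right[of n "rot ^^ k"] funpow.simps(2)[of n "\<lambda>x. op x c"] o_apply)
  qed simp
  from this[of m] show ?thesis using c_order[OF assms] by (simp add: funpow_mult mult.commute)
qed

text \<open>\<open>rot ^^ (k * m)\<close> lowers the index by \<open>2 * k * m\<close>, yet it is
  the identity.\<close>

lemma T_period: "T (j + 2 * k * m) = T j"
  using rot_pow_T[of "k * m" j] rot_order[of "T (j + 2 * k * m)"] by (simp add: mult.assoc)

lemma T_mod: "T (j mod (2 * k * m)) = T j"
  by (rule periodic_mod[of T, OF T_period])

text \<open>\<open>T (j + k)\<close> followed by \<open>T j\<close> acts as \<open>rot ^^ k\<close>,
  which fixes \<open>c\<close>. Hence the orbit of the strut has the shorter period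
  \<open>k\<close>.\<close>

lemma op_c_T_period: "op c (T (j + k)) = op c (T j)"
  using rot_pow[OF c_closed, of j k] rot_c invol[of "op c (T (j + k))" j] c_closed
  by (simp add: op_closed)

lemma op_c_T_mod: "op c (T (j mod k)) = op c (T j)"
  by (rule periodic_mod[of "\<lambda>j. op c (T j)", OF op_c_T_period])

text \<open>
  The elements \<open>op (op c (T j)) (T 0)\<close> are the images of \<open>c\<close> under the powers of \<open>rot\<close>.
\<close>
definition elements :: "'q set" where
  "elements = range T \<union> range (\<lambda>j. op c (T j)) \<union> range (\<lambda>j. op (op c (T j)) (T 0))"

lemma elements_subset: "elements \<subseteq> Q"
  by (auto simp: elements_def intro!: op_closed c_closed)

lemma elements_eq:
  "elements = T ` {..<2 * k * m} \<union> (\<lambda>j. op c (T j)) ` {..<k} \<union> (\<lambda>j. op (op c (T j)) (T 0)) ` {..<k}"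
proof
  have "T j \<in> T ` {..<2 * k * m}" for j
    using k m by (intro image_eqI[of _ _ "j mod (2 * k * m)"]) (auto simp: T_mod)
  moreover have "op c (T j) \<in> (\<lambda>j. op c (T j)) ` {..<k}" for j
    using k by (intro image_eqI[of _ _ "j mod k"]) (auto simp: op_c_T_mod)
  moreover have "op (op c (T j)) (T 0) \<in> (\<lambda>j. op (op c (T j)) (T 0)) ` {..<k}" for j
    using k by (intro image_eqI[of _ _ "j mod k"]) (auto simp: op_c_T_mod)
  ultimately show "elements \<subseteq> T ` {..<2 * k * m} \<union> (\<lambda>j. op c (T j)) ` {..<k}
      \<union> (\<lambda>j. op (op c (T j)) (T 0)) ` {..<k}"
    unfolding elements_def by blast
qed (auto simp: elements_def)

lemma finite_elements: "finite elements"
  by (simp add: elements_eq)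

lemma card_elements: "card elements \<le> 2 * k * m + 2 * k"
proof -
  have "card elements \<le> card (T ` {..<2 * k * m}) + card ((\<lambda>j. op c (T j)) ` {..<k})
      + card ((\<lambda>j. op (op c (T j)) (T 0)) ` {..<k})"
    unfolding elements_eq by (meson add_le_mono1 card_Un_le order_trans)
  also have "\<dots> \<le> 2 * k * m + k + k"
    by (intro add_mono order_trans[OF card_image_le]) auto
  finally show ?thesis by simp
qed

section \<open>Closure of the listed elements under the generators\<close>

lemma rot_range_T:
  assumes "x \<in> range T"
  shows "rot x \<in> range T"
proof -
  obtain j where j: "x = T j" using assms by blast
  \<comment> \<open>Adding the period makes the index at least 2, so \<open>rot_T\<close> also
    covers \<open>T 0\<close> and \<open>T 1\<close>.\<close>
  have "2 * k * m \<ge> 2" using k m by simp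
  then obtain n where "2 * k * m = Suc (Suc n)" by (metis add_2_eq_Suc le_Suc_ex)
  then have "x = T (Suc (Suc (j + n)))" using T_period[of j] j by simp
  then show ?thesis using rot_T by simp
qed

lemma op_T0_range_T:
  assumes "x \<in> range T"
  shows "op x (T 0) \<in> range T"
proof -
  obtain j where j: "x = T j" using assms by blast
  \<comment> \<open>By idempotence \<open>T j\<close> may act on itself first, which completes
    \<open>T 0\<close> to a power of \<open>rot\<close>.\<close>
  have "op x (T 0) = (rot ^^ j) (T j)"
    using rot_pow[of "T j" 0 j] idem[of "T j"] j by simp
  also have "\<dots> \<in> range T" by (rule funpow_mem) (auto intro: rot_range_T)
  finally show ?thesis .
qed

lemma op_T0_elements: "x \<in> elements \<Longrightarrow> op x (T 0) \<in> elements"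
  using op_T0_range_T unfolding elements_def by (auto simp: op_closed c_closed)

lemma op_T1_elements:
  assumes "x \<in> elements"
  shows "op x (T (Suc 0)) \<in> elements"
  using assms unfolding elements_def
proof (elim UnE rangeE)
  fix j assume x: "x = T j"
  have "op x (T (Suc 0)) = op (rot x) (T 0)"
    by (simp add: rot_def x op_closed)
  then show "op x (T (Suc 0)) \<in> range T \<union> range (\<lambda>j. op c (T j)) \<union> range (\<lambda>j. op (op c (T j)) (T 0))"
    using op_T0_range_T[OF rot_range_T[of x]] x by simp
next
  fix j assume x: "x = op c (T j)"
  \<comment> \<open>The index may be 0, so the period \<open>k\<close> is added. Then
    \<open>T (Suc n)\<close> before \<open>T 1\<close> and \<open>T n\<close> before
    \<open>T 0\<close> both act as \<open>rot ^^ n\<close>.\<close>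
  obtain n where n: "j + k = Suc n" using k by (metis add_Suc_right le_Suc_ex plus_1_eq_Suc)
  have "x = op c (T (Suc n))" using op_c_T_period[of j] n x by simp
  then have "op x (T (Suc 0)) = op (op c (T n)) (T 0)"
    using rot_pow[OF c_closed, of "Suc 0" n] rot_pow[OF c_closed, of 0 n] by simp
  then show "op x (T (Suc 0)) \<in> range T \<union> range (\<lambda>j. op c (T j)) \<union> range (\<lambda>j. op (op c (T j)) (T 0))"
    by blast
next
  fix j assume x: "x = op (op c (T j)) (T 0)"
  \<comment> \<open>The same shift of indices upwards; the final \<open>T 1\<close> then
    cancels.\<close>
  have "x = op (op c (T (Suc j))) (T (Suc 0))"
    using rot_pow[OF c_closed, of "Suc 0" j] rot_pow[OF c_closed, of 0 j] x by simp
  then have "op x (T (Suc 0)) = op c (T (Suc j))"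
    by (simp add: op_closed c_closed)
  then show "op x (T (Suc 0)) \<in> range T \<union> range (\<lambda>j. op c (T j)) \<union> range (\<lambda>j. op (op c (T j)) (T 0))"
    by blast
qed

lemma op_T_elements_pair:
  "(\<forall>x\<in>elements. op x (T j) \<in> elements) \<and> (\<forall>x\<in>elements. op x (T (Suc j)) \<in> elements)"
proof (induction j)
  case 0
  then show ?case using op_T0_elements op_T1_elements by blast
next
  case (Suc j)
  then show ?case using elements_subset by (auto simp: op_T_rec subset_iff)
qed

lemma op_T_elements: "x \<in> elements \<Longrightarrow> op x (T j) \<in> elements"
  using op_T_elements_pair by blast

lemma iop_T_elements: "x \<in> elements \<Longrightarrow> iop x (T j) \<in> elements"
  using op_T_elements iop_T elements_subset by (metis subsetD)

lemma rot_pow_elements: "x \<in> elements \<Longrightarrow> (rot ^^ n) x \<in> elements"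
  by (rule funpow_mem) (auto simp: rot_def intro: op_T_elements)

lemma T_in_elements: "T j \<in> elements"
  by (simp add: elements_def)

lemma c_in_elements: "c \<in> elements"
proof -
  \<comment> \<open>\<open>T k\<close> followed by \<open>T 0\<close> is \<open>rot ^^ k\<close>, so
    \<open>c\<close> is the member of the third family with \<open>j = k\<close>.\<close>
  have "op (op c (T k)) (T 0) = c"
    using rot_pow[OF c_closed, of 0 k] rot_c by simp
  then show ?thesis unfolding elements_def by (metis UnI2 rangeI)
qed

text \<open>\<open>rot_order\<close> makes the inverse of \<open>rot ^^ k\<close> a natural power,
  to which \<open>rot_pow_elements\<close> applies. The subtraction is exact since
  \<open>m \<ge> 1\<close>.\<close>

lemma rot_pow_inverse:
  assumes "x \<in> Q" "y \<in> Q" "(rot ^^ k) y = x"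
  shows "y = (rot ^^ (k * m - k)) x"
proof -
  have "(rot ^^ (k * m - k)) x = (rot ^^ (k * m - k + k)) y"
    using assms(3) by (simp add: funpow_add)
  also have "k * m - k + k = k * m"
    using m by simp
  finally show ?thesis using rot_order assms(2) by simp
qed

lemma op_iop_c_elements:
  assumes "x \<in> elements"
  shows "op x c \<in> elements \<and> iop x c \<in> elements"
proof -
  have x: "x \<in> Q" using assms elements_subset by blast
  have Q: "op x c \<in> Q" "iop x c \<in> Q" using x c_closed op_closed iop_closed by auto
  show ?thesis
    using vertex_rot
  proof
    assume op: "\<forall>x\<in>Q. op x c = (rot ^^ k) x"
    then have "iop x c = (rot ^^ (k * m - k)) x"
      using rot_pow_inverse[OF x Q(2)] op_iop[OF x c_closed] Q(2) by simp
    then show ?thesis using op x assms rot_pow_elements by simp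
  next
    assume iop: "\<forall>x\<in>Q. iop x c = (rot ^^ k) x"
    then have "op x c = (rot ^^ (k * m - k)) x"
      using rot_pow_inverse[OF x Q(1)] iop_op[OF x c_closed] Q(1) by simp
    then show ?thesis using iop x assms rot_pow_elements by simp
  qed
qed

end

section \<open>A dihedral model\<close>

text \<open>
  \<open>Refl j\<close> stands for the strand with index \<open>j\<close> modulo \<open>2 * k * m\<close>, and \<open>Turn u s\<close> for an
  element of the orbit of the strut, with \<open>u\<close> modulo \<open>k\<close>; the sign \<open>s\<close> says whether it
  acts on the strands as \<open>rot ^^ k\<close> or as its inverse.
\<close>
datatype point = Refl int | Turn int int

text \<open>Acting by \<open>Refl 1\<close> and then \<open>Refl 0\<close> lowers the index of a
  \<open>Refl\<close> by 2 and adds \<open>s\<close> to the position of \<open>Turn u s\<close>. The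
  \<open>k\<close>-th power of this is the action of a \<open>Turn\<close> with sign 1, trivial on
  positions modulo \<open>k\<close>.\<close>

fun mop :: "int \<Rightarrow> int \<Rightarrow> point \<Rightarrow> point \<Rightarrow> point" where
  "mop k m (Refl x) (Refl y) = Refl ((2 * y - x) mod (2 * k * m))"
| "mop k m (Refl x) (Turn v t) = Refl ((x - 2 * k * t) mod (2 * k * m))"
| "mop k m (Turn u s) (Refl y) = Turn ((u + s * y) mod k) (- s)"
| "mop k m (Turn u s) (Turn v t) = Turn u s"

fun miop :: "int \<Rightarrow> int \<Rightarrow> point \<Rightarrow> point \<Rightarrow> point" where
  "miop k m (Refl x) (Turn v t) = Refl ((x + 2 * k * t) mod (2 * k * m))"
| "miop k m p q = mop k m p q"

definition points :: "int \<Rightarrow> int \<Rightarrow> point set" where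
  "points k m = Refl ` {0..<2 * k * m} \<union> case_prod Turn ` ({0..<k} \<times> {-1, 1})"

lemma points_simps [simp]:
  "Refl x \<in> points k m \<longleftrightarrow> 0 \<le> x \<and> x < 2 * k * m"
  "Turn u s \<in> points k m \<longleftrightarrow> 0 \<le> u \<and> u < k \<and> (s = 1 \<or> s = -1)"
  by (auto simp: points_def)

lemma card_points:
  assumes "k \<ge> 0" "m \<ge> 0"
  shows "int (card (points k m)) = 2 * k * m + 2 * k"
proof -
  have "inj_on (case_prod Turn) ({0..<k} \<times> {-1, 1})" "inj_on Refl {0..<2 * k * m}"
    by (auto simp: inj_on_def)
  moreover have "Refl ` {0..<2 * k * m} \<inter> case_prod Turn ` ({0..<k} \<times> {-1, 1}) = {}"
    by auto
  ultimately show ?thesis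
    using assms unfolding points_def
    by (subst card_Un_disjoint) (simp_all add: card_image card_cartesian_product)
qed

text \<open>Strand indices live modulo \<open>2 * k * m\<close>, strut positions modulo
  \<open>k\<close>; the reductions are compatible because \<open>k\<close> divides
  \<open>2 * k * m\<close>.\<close>

lemma mod_inner:
  fixes k m u s y :: int
  shows "(u + s * (y mod (2 * k * m))) mod k = (u + s * y) mod k"
    "(u - s * (y mod (2 * k * m))) mod k = (u - s * y) mod k"
proof -
  have y: "y mod (2 * k * m) mod k = y mod k"
    by (rule mod_mod_cancel) simp
  show "(u + s * (y mod (2 * k * m))) mod k = (u + s * y) mod k"
    using y by (metis mod_add_right_eq mod_mult_right_eq)
  show "(u - s * (y mod (2 * k * m))) mod k = (u - s * y) mod k"
    using y by (metis mod_diff_right_eq mod_mult_right_eq)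
qed

lemma mod_double:
  fixes x y n :: int
  shows "(2 * (x mod n) - y) mod n = (2 * x - y) mod n"
  by (metis mod_diff_left_eq mod_mult_right_eq)

lemma mop_Refl_mod: "mop k m p (Refl (j mod (2 * k * m))) = mop k m p (Refl j)"
  by (cases p) (simp_all add: mod_double mod_inner)

lemma miop_Refl: "miop k m p (Refl j) = mop k m p (Refl j)"
  by (cases p) simp_all

lemma miop_Turn: "miop k m p (Turn v t) = mop k m p (Turn v (- t))"
  by (cases p) simp_all

lemma quandle_points:
  assumes "k \<ge> 1" "m \<ge> 1"
  shows "quandle (points k m) (mop k m) (miop k m)"
proof
  have km: "2 * k * m > 0" using assms by simp
  fix x y assume x: "x \<in> points k m" and y: "y \<in> points k m"
  show "mop k m x y \<in> points k m"
    using x y assms km by (cases x; cases y) auto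
  show "miop k m x y \<in> points k m"
    using x y assms km by (cases x; cases y) auto
  show "mop k m x x = x"
    using x by (cases x) auto
  show "miop k m (mop k m x y) y = x"
    using x y by (cases x; cases y) (auto simp: mod_simps)
  show "mop k m (miop k m x y) y = x"
    using x y by (cases x; cases y) (auto simp: mod_simps)
  fix z assume z: "z \<in> points k m"
  have shift: "(u + (j + k * t)) mod k = (u + j) mod k" for u j t :: int
    by (simp flip: add.assoc)
  show "mop k m (mop k m x y) z = mop k m (mop k m x z) (mop k m y z)"
  proof (cases x; cases y; cases z)
    fix u s j v t
    assume *: "x = Turn u s" "y = Refl j" "z = Turn v t"
    \<comment> \<open>A \<open>Turn\<close> moves the index \<open>j\<close> by a multiple of
      \<open>k\<close>, which a position modulo \<open>k\<close> does not see.\<close>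
    have "(u + s * (j - 2 * k * t)) mod k = (u + (s * j + k * (- (2 * s * t)))) mod k"
      by (simp add: algebra_simps)
    also have "\<dots> = (u + s * j) mod k"
      by (rule shift)
    finally show ?thesis using * by (simp add: mod_inner)
  qed (simp_all add: mod_simps mod_inner mod_double, simp_all add: algebra_simps)
qed

section \<open>The N-quandle of G(k,m)\<close>

definition G_rels :: "nat \<Rightarrow> nat \<Rightarrow> (nat \<Rightarrow> bool) \<Rightarrow> (G_arc qterm \<times> G_arc qterm) set" where
  "G_rels k m d = diagram_rels (G_diagram k d) \<union> label_rels (G_diagram k d) [2, 2, m]"

definition G_arcs :: "nat \<Rightarrow> G_arc set" where
  "G_arcs k = insert Strut (Strand ` {0..k + 1})"

lemma arcs_G_diagram: "arcs (G_diagram k d) = G_arcs k"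
  by (simp add: G_diagram_def G_arcs_def Let_def)

lemma edge_of_G_diagram: "edge_of (G_diagram k d) = G_edge k"
  by (simp add: G_diagram_def Let_def)

lemma fundamental_N_quandle_G:
  "fundamental_N_quandle (G_diagram k d) [2, 2, m] = presented (G_arcs k) (G_rels k m d)"
  by (simp add: fundamental_N_quandle_def G_rels_def arcs_G_diagram)

text \<open>Built from the first two strands alone, so that the sequence continues past the last arc
  \<open>Strand (k + 1)\<close>.\<close>

fun strand_term :: "nat \<Rightarrow> G_arc qterm" where
  "strand_term 0 = Gen (Strand 0)"
| "strand_term (Suc 0) = Gen (Strand 1)"
| "strand_term (Suc (Suc j)) = strand_term j \<rhd> strand_term (Suc j)"

lemma strand_term_qterms: "strand_term j \<in> qterms (G_arcs k)"
  by (induction j rule: strand_term.induct) (auto simp: G_arcs_def)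

text \<open>A downward strut leaves the upper vertex, where the relation makes its inverse act as
  \<open>rot ^^ k\<close>; hence the sign -1.\<close>

fun arc_point :: "nat \<Rightarrow> nat \<Rightarrow> (nat \<Rightarrow> bool) \<Rightarrow> G_arc \<Rightarrow> point" where
  "arc_point k m d Strut = Turn 0 (if d 2 then -1 else 1)"
| "arc_point k m d (Strand j) = Refl (int j mod (2 * int k * int m))"

abbreviation point_eval :: "nat \<Rightarrow> nat \<Rightarrow> (nat \<Rightarrow> bool) \<Rightarrow> G_arc qterm \<Rightarrow> point" where
  "point_eval k m d \<equiv> qeval (mop (int k) (int m)) (miop (int k) (int m)) (arc_point k m d)"

context
  fixes k m :: nat and d :: "nat \<Rightarrow> bool"
  assumes k: "k \<ge> 1" and m: "m \<ge> 1"
begin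

interpretation M: quandle "points (int k) (int m)" "mop (int k) (int m)" "miop (int k) (int m)"
  by (rule quandle_points) (use k m in auto)

section \<open>The dihedral model satisfies the diagram and label relations\<close>

lemma arc_point_points: "arc_point k m d ` G_arcs k \<subseteq> points (int k) (int m)"
  using k m by (auto simp: G_arcs_def)

text \<open>The over-arc index is the midpoint of the two under-arc indices, so its reflection swaps
  them and either orientation is fine.\<close>

lemma point_eval_crossing:
  assumes "(xk, xj, xi) \<in> crossings (G_diagram k d)"
  shows "arc_point k m d xi = mop (int k) (int m) (arc_point k m d xk) (arc_point k m d xj)"
proof -
  obtain i where "(xk, xj, xi) = (Strand (i + 2), Strand (i + 1), Strand i) \<or>
      (xk, xj, xi) = (Strand i, Strand (i + 1), Strand (i + 2))"
    using assms by (auto simp: G_diagram_def Let_def split: if_splits)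
  then show ?thesis
    by (elim disjE) (simp_all add: mod_double mod_simps algebra_simps)
qed

lemma point_eval_signed_strand:
  "point_eval k m d (signed_op x (Strand j, b)) =
    mop (int k) (int m) (point_eval k m d x) (Refl (int j))"
  by (simp add: signed_op_def miop_Refl mop_Refl_mod)

lemma point_eval_signed_strut:
  "point_eval k m d (signed_op x (Strut, b)) =
    mop (int k) (int m) (point_eval k m d x) (Turn 0 (if b = d 2 then -1 else 1))"
  by (simp add: signed_op_def miop_Turn)

text \<open>The strand indices at a vertex differ by \<open>k\<close>. Their reflections multiply to
  a shift of \<open>Refl\<close> indices by \<open>2 * k\<close>, which the strut cancels, and move
  positions of \<open>Turn\<close> by multiples of \<open>k\<close>.\<close>

lemma point_eval_vertex:
  assumes v: "v \<in> vertices (G_diagram k d)" and x: "point_eval k m d x \<in> points (int k) (int m)"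
  shows "point_eval k m d (foldl signed_op x v) = point_eval k m d x"
proof -
  obtain b b' where "v = [(Strut, \<not> d 2), (Strand 1, b), (Strand (k + 1), b')] \<or>
      v = [(Strut, d 2), (Strand k, b), (Strand 0, b')]"
    using v by (auto simp: G_diagram_def Let_def)
  \<comment> \<open>The total shift by \<open>k\<close> of a \<open>Turn\<close> with sign -1 under
    the strands 1 and \<open>k + 1\<close> of the upper vertex.\<close>
  moreover have "(1 + (int k + (u - 1) mod int k)) mod int k = u mod int k" for u
    using mod_add_right_eq[of "1 + int k" "u - 1" "int k"] by (simp add: algebra_simps)
  ultimately show ?thesis
    using x
    by (cases "point_eval k m d x")
      (auto simp: point_eval_signed_strand point_eval_signed_strut mod_simps algebra_simps)
qed

lemma strut_pow_Refl:
  "x \<in> {0..<2 * int k * int m} \<Longrightarrow>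
    ((\<lambda>q. mop (int k) (int m) q (Turn v t)) ^^ n) (Refl x) = Refl ((x - 2 * int k * t * int n) mod (2 * int k * int m))"
  by (induction n) (auto simp: mod_simps algebra_simps)

lemma strut_pow_Turn: "((\<lambda>q. mop k' m' q (Turn v t)) ^^ n) (Turn u s) = Turn u s"
  by (induction n) auto

lemma point_eval_label:
  assumes "y \<in> G_arcs k" "p \<in> points (int k) (int m)"
  shows "((\<lambda>q. mop (int k) (int m) q (arc_point k m d y)) ^^ ([2, 2, m] ! G_edge k y)) p = p"
proof (cases y)
  case Strut
  \<comment> \<open>Acting \<open>m\<close> times, the strut shifts the index by a multiple of the
    full period.\<close>
  have "(x - 2 * int k * t * int m) mod (2 * int k * int m) = x mod (2 * int k * int m)" for x t
  proof -
    have "x - 2 * int k * t * int m = x + 2 * int k * int m * (- t)"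
      by (simp add: algebra_simps)
    then show ?thesis by (simp only: mod_mult_self2)
  qed
  then show ?thesis
    using Strut assms(2) by (cases p) (simp_all add: strut_pow_Refl strut_pow_Turn)
next
  case (Strand j)
  then have "[2, 2, m] ! G_edge k y = 2" by simp
  then show ?thesis
    using Strand assms(2) by (cases p) (auto simp: numeral_2_eq_2 mod_simps mod_double mod_inner)
qed

lemma point_eval_respects:
  assumes "qeq (G_arcs k) (G_rels k m d) s t"
  shows "point_eval k m d s = point_eval k m d t"
proof (rule M.qeval_respects[OF arc_point_points _ assms])
  fix s t
  assume st: "(s, t) \<in> G_rels k m d" "t \<in> qterms (G_arcs k)"
  have t: "point_eval k m d t \<in> points (int k) (int m)"
    using M.qeval_closed[OF arc_point_points st(2)] .
  show "point_eval k m d s = point_eval k m d t"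
    using st(1) t
    by (auto simp: G_rels_def diagram_rels_def label_rels_def point_eval_vertex qeval_funpow_op
      arcs_G_diagram edge_of_G_diagram point_eval_label dest: point_eval_crossing)
qed

section \<open>Surjectivity onto the model and the lower bound\<close>

lemma point_eval_strand_term:
  "point_eval k m d (strand_term j) = Refl (int j mod (2 * int k * int m))"
  by (induction j rule: strand_term.induct) (auto simp: mod_simps mod_double algebra_simps)

lemma points_covered:
  assumes "p \<in> points (int k) (int m)"
  shows "\<exists>t\<in>qterms (G_arcs k). point_eval k m d t = p"
proof (cases p)
  case (Refl x)
  then have "point_eval k m d (strand_term (nat x)) = p"
    using assms by (simp add: point_eval_strand_term)
  then show ?thesis using strand_term_qterms by blast
next
  case (Turn u s)
  define e :: int where "e = (if d 2 then -1 else 1)"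
  \<comment> \<open>The strut is \<open>Turn 0 e\<close>, and the strand \<open>j\<close> takes it
    to position \<open>e * j\<close>; since \<open>e * e = 1\<close>, position \<open>u\<close>
    needs \<open>j = e * u\<close>, reduced modulo \<open>k\<close> to be nonnegative.\<close>
  define c where "c = Gen Strut \<rhd> strand_term (nat ((e * u) mod int k))"
  have e: "e * e = 1" "e = 1 \<or> e = -1" by (auto simp: e_def)
  have u: "0 \<le> u" "u < int k" "s = 1 \<or> s = - 1" using assms Turn by auto
  have "(e * ((e * u) mod int k)) mod int k = (e * (e * u)) mod int k"
    by (simp add: mod_simps)
  also have "\<dots> = u" using e(1) u by (simp flip: mult.assoc)
  finally have "point_eval k m d c = Turn u (- e)"
    using k mod_inner(1)[of 0 e _ "int k" "int m"]
    by (simp add: c_def point_eval_strand_term flip: e_def)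
  \<comment> \<open>\<open>Strand 0\<close> flips the sign and keeps the position, so both signs are
    reached.\<close>
  then have "point_eval k m d c = p \<or> point_eval k m d (c \<rhd> Gen (Strand 0)) = p"
    using u e Turn by auto
  moreover have "c \<in> qterms (G_arcs k)"
    by (simp add: c_def strand_term_qterms) (simp add: G_arcs_def)
  moreover have "Gen (Strand 0) \<in> qterms (G_arcs k)"
    by (simp add: G_arcs_def)
  ultimately show ?thesis by (metis qterms_simps(2))
qed

abbreviation cls :: "G_arc qterm \<Rightarrow> G_arc qterm set" where
  "cls t \<equiv> qrel (G_arcs k) (G_rels k m d) `` {t}"

abbreviation G_quandle :: "G_arc qterm set set" where
  "G_quandle \<equiv> presented (G_arcs k) (G_rels k m d)"

abbreviation G_op :: "G_arc qterm set \<Rightarrow> G_arc qterm set \<Rightarrow> G_arc qterm set" where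
  "G_op \<equiv> presented_op (G_arcs k) (G_rels k m d)"

abbreviation G_iop :: "G_arc qterm set \<Rightarrow> G_arc qterm set \<Rightarrow> G_arc qterm set" where
  "G_iop \<equiv> presented_iop (G_arcs k) (G_rels k m d)"

lemma card_points_le:
  assumes "finite G_quandle"
  shows "2 * k * m + 2 * k \<le> card G_quandle"
proof -
  \<comment> \<open>The choice of a representative is harmless, since related terms have equal
    values by \<open>point_eval_respects\<close>.\<close>
  define h where "h X = point_eval k m d (SOME t. t \<in> X)" for X
  have h: "h (cls t) = point_eval k m d t"
    if "t \<in> qterms (G_arcs k)" for t
  proof -
    have "t \<in> cls t"
      using that by (simp add: qrel_def qeq.refl)
    then have "(SOME t'. t' \<in> cls t) \<in> cls t"
      by (rule someI)
    then show ?thesis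
      unfolding h_def using point_eval_respects by (simp add: qrel_def)
  qed
  have "points (int k) (int m) \<subseteq> h ` G_quandle"
  proof
    fix p assume "p \<in> points (int k) (int m)"
    then obtain t where "t \<in> qterms (G_arcs k)" "point_eval k m d t = p"
      using points_covered by blast
    then show "p \<in> h ` G_quandle"
      using h by (intro image_eqI[of _ _ "cls t"])
        (auto simp: presented_def intro: quotientI)
  qed
  then have "card (points (int k) (int m)) \<le> card G_quandle"
    using assms by (meson card_mono card_image_le finite_imageI order_trans)
  moreover have "card (points (int k) (int m)) = 2 * k * m + 2 * k"
    using card_points[of "int k" "int m"] by (simp flip: of_nat_eq_iff[where 'a = int])
  ultimately show ?thesis by simp
qed

section \<open>The presented quandle meets the hypotheses of the upper bound\<close>

interpretation P: quandle G_quandle G_op G_iop by (rule quandle_presented)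

lemma cls_rel:
  "(s, t) \<in> G_rels k m d \<Longrightarrow> s \<in> qterms (G_arcs k) \<Longrightarrow> t \<in> qterms (G_arcs k) \<Longrightarrow> cls s = cls t"
  by (rule qrel_class_eq) (rule qeq.rel)

lemma cls_closed: "t \<in> qterms (G_arcs k) \<Longrightarrow> cls t \<in> G_quandle"
  by (simp add: presented_def quotientI)

lemma cls_cases:
  assumes "X \<in> G_quandle"
  obtains t where "t \<in> qterms (G_arcs k)" "X = cls t"
  using assms unfolding presented_def by (rule quotientE)

lemma cls_label:
  assumes "y \<in> G_arcs k" "X \<in> G_quandle"
  shows "((\<lambda>X. G_op X (cls (Gen y))) ^^ ([2, 2, m] ! G_edge k y)) X = X"
proof -
  obtain t where t: "t \<in> qterms (G_arcs k)" "X = cls t" using assms(2) by (rule cls_cases)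
  have pow: "((\<lambda>t. t \<rhd> Gen y) ^^ n) t \<in> qterms (G_arcs k) \<and>
      ((\<lambda>X. G_op X (cls (Gen y))) ^^ n) X = cls (((\<lambda>t. t \<rhd> Gen y) ^^ n) t)" for n
    by (induction n) (use t assms(1) in \<open>auto simp: presented_op_class\<close>)
  moreover have "(((\<lambda>t. t \<rhd> Gen y) ^^ ([2, 2, m] ! G_edge k y)) t, t) \<in> G_rels k m d"
    using t(1) assms(1) unfolding G_rels_def label_rels_def arcs_G_diagram edge_of_G_diagram by blast
  ultimately show ?thesis using cls_rel t by metis
qed

lemma cls_strand_invol:
  assumes "j \<le> Suc k" "X \<in> G_quandle"
  shows "G_op (G_op X (cls (Gen (Strand j)))) (cls (Gen (Strand j))) = X"
proof -
  have "[2, 2, m] ! G_edge k (Strand j) = Suc (Suc 0)" by simp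
  then show ?thesis using cls_label[of "Strand j" X] assms by (simp add: G_arcs_def)
qed

lemma cls_strand_iop:
  assumes "j \<le> Suc k" "X \<in> G_quandle"
  shows "G_iop X (cls (Gen (Strand j))) = G_op X (cls (Gen (Strand j)))"
proof -
  have c: "cls (Gen (Strand j)) \<in> G_quandle"
    using assms(1) by (intro cls_closed) (simp add: G_arcs_def)
  show ?thesis
    using P.iop_eq_iff[OF assms(2) P.op_closed[OF assms(2) c] c] cls_strand_invol[OF assms] by simp
qed

lemma crossing_mem:
  assumes "i < k"
  shows "(if d (G_edge k (Strand (i + 1))) then (Strand (i + 2), Strand (i + 1), Strand i)
    else (Strand i, Strand (i + 1), Strand (i + 2))) \<in> crossings (G_diagram k d)"
  using assms unfolding G_diagram_def Let_def diagram.simps by blast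

text \<open>Reversing the over-strand exchanges the two under-arcs in the relation, which is
  equivalent because the over-strand acts as an involution.\<close>

lemma cls_crossing:
  assumes "i < k"
  shows "cls (Gen (Strand (i + 2))) =
    G_op (cls (Gen (Strand i))) (cls (Gen (Strand (i + 1))))"
proof -
  have mem: "Gen (Strand j) \<in> qterms (G_arcs k)" if "j \<le> i + 2" for j
    using that assms by (simp add: G_arcs_def)
  show ?thesis
  proof (cases "d (G_edge k (Strand (i + 1)))")
    case True
    then have "(Strand (i + 2), Strand (i + 1), Strand i) \<in> crossings (G_diagram k d)"
      using crossing_mem[OF assms] by (simp only: if_True if_False)
    then have "(Gen (Strand i), Gen (Strand (i + 2)) \<rhd> Gen (Strand (i + 1))) \<in> G_rels k m d"
      unfolding G_rels_def diagram_rels_def by blast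
    then have "cls (Gen (Strand i)) = cls (Gen (Strand (i + 2)) \<rhd> Gen (Strand (i + 1)))"
      by (rule cls_rel) (use mem in auto)
    then show ?thesis
      using cls_strand_invol[of "i + 1" "cls (Gen (Strand (i + 2)))"] assms mem
      by (simp add: presented_op_class cls_closed)
  next
    case False
    then have "(Strand i, Strand (i + 1), Strand (i + 2)) \<in> crossings (G_diagram k d)"
      using crossing_mem[OF assms] by (simp only: if_True if_False)
    then have "(Gen (Strand (i + 2)), Gen (Strand i) \<rhd> Gen (Strand (i + 1))) \<in> G_rels k m d"
      unfolding G_rels_def diagram_rels_def by blast
    then have "cls (Gen (Strand (i + 2))) = cls (Gen (Strand i) \<rhd> Gen (Strand (i + 1)))"
      by (rule cls_rel) (use mem in auto)
    then show ?thesis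
      using mem by (simp add: presented_op_class)
  qed
qed

lemma cls_strand_term: "j \<le> Suc k \<Longrightarrow> cls (strand_term j) = cls (Gen (Strand j))"
proof (induction j rule: strand_term.induct)
  \<comment> \<open>The bound on the index \<open>j + 2\<close> says exactly that crossing
    \<open>j\<close> lies in the block.\<close>
  case (3 j)
  then show ?case
    using cls_crossing[of j] strand_term_qterms by (simp flip: presented_op_class)
qed simp_all

text \<open>The relation at the upper vertex solved for the strut: the strands are involutions in
  either direction, so they move to the other side in reverse order.\<close>

lemma cls_vertex:
  assumes "X \<in> G_quandle"
  shows "(if d 2 then G_iop else G_op) X (cls (Gen Strut)) =
    G_op (G_op X (cls (Gen (Strand (Suc k))))) (cls (Gen (Strand (Suc 0))))"
    (is "?Y = _")
proof -
  let ?s = "\<lambda>j. cls (Gen (Strand j))"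
  obtain t where t: "t \<in> qterms (G_arcs k)" "X = cls t" using assms by (rule cls_cases)
  have mem: "Gen Strut \<in> qterms (G_arcs k)" "Gen (Strand (Suc 0)) \<in> qterms (G_arcs k)"
      "Gen (Strand (Suc k)) \<in> qterms (G_arcs k)"
    by (auto simp: G_arcs_def)
  define v where "v = [(Strut, \<not> d 2), (Strand 1, \<not> d (G_edge k (Strand 1))),
    (Strand (k + 1), d (G_edge k (Strand (k + 1))))]"
  have "v \<in> vertices (G_diagram k d)"
    unfolding v_def G_diagram_def Let_def by simp
  then have "(foldl signed_op t v, t) \<in> G_rels k m d"
    using t(1) unfolding G_rels_def diagram_rels_def arcs_G_diagram by blast
  then have "cls (foldl signed_op t v) = cls t"
    by (rule cls_rel) (use t mem in \<open>auto simp: v_def signed_op_def\<close>)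
  moreover have Y: "?Y \<in> G_quandle"
    using P.op_closed P.iop_closed assms cls_closed[OF mem(1)] by simp
  moreover have Z: "G_op ?Y (?s (Suc 0)) \<in> G_quandle"
    using Y P.op_closed cls_closed[OF mem(2)] by simp
  moreover have "cls (foldl signed_op t v) = G_op (G_op ?Y (?s (Suc 0))) (?s (Suc k))"
  proof -
    have 1: "cls (signed_op t (Strut, \<not> d 2)) = ?Y"
      using t mem by (simp add: signed_op_def presented_op_class presented_iop_class)
    have q: "signed_op u (Strand j, b) \<in> qterms (G_arcs k) \<and>
        cls (signed_op u (Strand j, b)) = G_op (cls u) (?s j)"
      if "u \<in> qterms (G_arcs k)" "j \<le> Suc k" for u j b
      using that cls_strand_iop[OF that(2) cls_closed[OF that(1)]]
      by (simp add: signed_op_def G_arcs_def flip: presented_op_class presented_iop_class)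
    have "signed_op t (Strut, \<not> d 2) \<in> qterms (G_arcs k)"
      using t mem by (simp add: signed_op_def)
    then show ?thesis
      using 1 q by (simp add: v_def)
  qed
  ultimately have "G_op (G_op ?Y (?s (Suc 0))) (?s (Suc k)) = X" using t by simp
  then show ?thesis
    using cls_strand_invol[OF _ Y, of "Suc 0"] cls_strand_invol[OF _ Z, of "Suc k"] by simp
qed

interpretation P: twisted_quandle G_quandle G_op G_iop k m "\<lambda>j. cls (strand_term j)" "cls (Gen Strut)"
proof
  show "cls (Gen Strut) \<in> G_quandle"
    by (rule cls_closed) (simp add: G_arcs_def)
  show "((\<lambda>x. G_op x (cls (Gen Strut))) ^^ m) X = X"
    if "X \<in> G_quandle" for X using cls_label[of Strut X] that by (simp add: G_arcs_def)
  show "(\<forall>x\<in>G_quandle. G_op x (cls (Gen Strut)) = G_op (G_op x (cls (strand_term (Suc k)))) (cls (strand_term (Suc 0)))) \<or>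
    (\<forall>x\<in>G_quandle. G_iop x (cls (Gen Strut)) = G_op (G_op x (cls (strand_term (Suc k)))) (cls (strand_term (Suc 0))))"
    using cls_vertex cls_strand_term[of "Suc k"] cls_strand_term[of "Suc 0"] by (cases "d 2") auto
  show "cls (strand_term 0) \<in> G_quandle"
    "cls (strand_term (Suc 0)) \<in> G_quandle"
    by (intro cls_closed strand_term_qterms)+
  show "cls (strand_term (Suc (Suc j))) = G_op (cls (strand_term j)) (cls (strand_term (Suc j)))" for j
    by (simp add: presented_op_class strand_term_qterms)
  show "G_op (G_op X (cls (strand_term 0))) (cls (strand_term 0)) = X"
    "G_op (G_op X (cls (strand_term (Suc 0)))) (cls (strand_term (Suc 0))) = X"
    if "X \<in> G_quandle" for X
    using that cls_strand_invol[of 0] cls_strand_invol[of "Suc 0"] by simp_all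
qed (rule k m)+

text \<open>Each class is the value of a term at the generator classes, and these are the strut or
  strands, under whose actions \<open>P.elements\<close> is stable.\<close>

lemma presented_subset: "G_quandle \<subseteq> P.elements"
proof
  fix X assume "X \<in> G_quandle"
  then obtain t where t: "t \<in> qterms (G_arcs k)" "X = cls t" by (rule cls_cases)
  have gen: "g = Strut \<or> (\<exists>j. cls (Gen g) = cls (strand_term j))" if "g \<in> G_arcs k" for g
    using that cls_strand_term by (fastforce simp: G_arcs_def)
  have "qeval G_op G_iop (\<lambda>g. cls (Gen g)) t \<in> P.elements"
  proof (rule P.qeval_mem_closed[OF P.elements_subset _ _ _ t(1)])
    show "(\<lambda>g. cls (Gen g)) ` G_arcs k \<subseteq> P.elements"
      using gen P.T_in_elements P.c_in_elements by fastforce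
  qed (use gen P.op_T_elements P.iop_T_elements P.op_iop_c_elements in metis)+
  then show "X \<in> P.elements" using t by (simp add: qeval_presented)
qed

lemma finite_card_presented:
  "finite G_quandle \<and> card G_quandle = 2 * k * m + 2 * k"
proof -
  have fin: "finite G_quandle"
    using finite_subset[OF presented_subset P.finite_elements] .
  moreover have "card G_quandle \<le> 2 * k * m + 2 * k"
    using card_mono[OF P.finite_elements presented_subset] P.card_elements by linarith
  ultimately show ?thesis using card_points_le by (simp add: le_antisym)
qed

end

theorem corollary5p2:
  fixes k m :: nat and d :: "nat \<Rightarrow> bool"
  assumes "k \<ge> 1" and "m \<ge> 1"
  shows "finite (fundamental_N_quandle (G_diagram k d) [2, 2, m]) \<and>
    card (fundamental_N_quandle (G_diagram k d) [2, 2, m]) = 2 * k * m + 2 * k"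
  using finite_card_presented[OF assms] by (simp add: fundamental_N_quandle_G)

end
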